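(* Let $\Omega\subset\mathbb R^n$ be a connected open set, let $w\in C^1(\Omega)$ be nonnegative and such that the measure $\mu=w\,\mathcal L^n$ satisfies $\mu(B)>0$ for any ball $B\subset\Omega$, and let $u\in C^2(\Omega)$. Then for any $x\in\Omega$ such that $w(x)\ne0$, $$\Delta_\mu^{\mathsf d_e}u(x)=c_n\,\frac{L_wu(x)}{w(x)},\qquad c_n=\frac1{2(n+2)},$$ where $L_wu:=w\,\Delta u+2\nabla w\cdot\nabla u$. Moreover, for any $x\in\Omega$ such that $w(x)=0$, assume that $$b^r(x):=\frac1{r^2}\,\frac{1}{\mu(B_r(x))}\int_{B_r(x)}(y-x)\,w(y)\,dy\quad\text{and}\quad a^r_{ij}(x):=\frac1{2r^2}\,\frac{1}{\mu(B_r(x))}\int_{B_r(x)}(y-x)_i(y-x)_j\,w(y)\,dy$$ converge to $b(x)\in\mathbb R^n$ and $a_{ij}(x)\in\mathbb R$ $(1\le i,j\le n)$ respectively when $r\to0^+$. Then $$\Delta_\mu^{\mathsf d_e}u(x)=\sum_{i,j=1}^na_{ij}(x)\,\partial_{ij}u(x)+b(x)\cdot\nabla u(x).$$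
   Context: $\mathcal L^n$ is Lebesgue measure on $\mathbb R^n$, $\mathsf d_e$ the Euclidean distance, $B_r(x)$ the Euclidean ball of center $x$ and radius $r$, and $\Delta=\sum_{k=1}^n\partial_{kk}$. The asymptotic mean value (AMV) Laplacian is $$\Delta_\mu^{\mathsf d_e}u(x):=\lim_{r\to0^+}\frac1{r^2}\,\frac1{\mu(B_r(x))}\int_{B_r(x)}\big(u(y)-u(x)\big)\,d\mu(y),$$ and an equality for $\Delta_\mu^{\mathsf d_e}u(x)$ includes the assertion that this limit exists. *)

theory Defs
  imports "HOL-Analysis.Analysis"
begin

definition partial_deriv :: "'n::finite \<Rightarrow> (real^'n \<Rightarrow> real) \<Rightarrow> real^'n \<Rightarrow> real" where
  "partial_deriv i f x = deriv (\<lambda>t. f (x + t *\<^sub>R axis i 1)) 0"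

definition grad :: "(real^'n::finite \<Rightarrow> real) \<Rightarrow> real^'n \<Rightarrow> real^'n" where
  "grad f x = (\<chi> i. partial_deriv i f x)"

definition laplacian :: "(real^'n::finite \<Rightarrow> real) \<Rightarrow> real^'n \<Rightarrow> real" where
  "laplacian f x = (\<Sum>k\<in>UNIV. partial_deriv k (partial_deriv k f) x)"

text \<open>The class \<open>C\<^sup>k(S)\<close>, meant for open \<open>S\<close>. Functions are total on \<open>real^'n\<close>, but for
  open \<open>S\<close> the predicate depends only on the values of \<open>f\<close> on \<open>S\<close>.\<close>

fun Ck_on :: "nat \<Rightarrow> (real^'n::finite) set \<Rightarrow> (real^'n \<Rightarrow> real) \<Rightarrow> bool" where
  "Ck_on 0 S f \<longleftrightarrow> continuous_on S f"
| "Ck_on (Suc k) S f \<longleftrightarrow> f differentiable_on S \<and> (\<forall>i. Ck_on k S (partial_deriv i f))"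

text \<open>The measure \<open>w \<L>\<^sup>n\<close> on \<open>S\<close>, extended by zero outside \<open>S\<close> to a measure on the whole space.\<close>

definition weighted_measure :: "(real^'n::finite) set \<Rightarrow> (real^'n \<Rightarrow> real) \<Rightarrow> (real^'n) measure" where
  "weighted_measure S w = density lebesgue (\<lambda>y. ennreal (indicator S y * w y))"

text \<open>The AMV Laplacian of \<open>u\<close> at \<open>x\<close> with respect to \<open>\<mu>\<close> and the Euclidean distance exists
  and equals \<open>L\<close>.\<close>

definition has_amv_laplacian ::
    "(real^'n::finite) measure \<Rightarrow> (real^'n \<Rightarrow> real) \<Rightarrow> real^'n \<Rightarrow> real \<Rightarrow> bool" where
  "has_amv_laplacian \<mu> u x L \<longleftrightarrow>
     ((\<lambda>r. 1 / r\<^sup>2 * (1 / measure \<mu> (ball x r)) * (LINT y:ball x r|\<mu>. u y - u x))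
        \<longlongrightarrow> L) (at_right 0)"

definition weighted_laplacian :: "(real^'n::finite \<Rightarrow> real) \<Rightarrow> (real^'n \<Rightarrow> real) \<Rightarrow> real^'n \<Rightarrow> real" where
  "weighted_laplacian w u x = w x * laplacian u x + 2 * (grad w x \<bullet> grad u x)"

definition first_moment ::
    "(real^'n::finite) set \<Rightarrow> (real^'n \<Rightarrow> real) \<Rightarrow> real^'n \<Rightarrow> real \<Rightarrow> real^'n" where
  "first_moment S w x r =
     (1 / r\<^sup>2 * (1 / measure (weighted_measure S w) (ball x r))) *\<^sub>R
       (LINT y:ball x r|lebesgue. w y *\<^sub>R (y - x))"

definition second_moment ::
    "(real^'n::finite) set \<Rightarrow> (real^'n \<Rightarrow> real) \<Rightarrow> real^'n \<Rightarrow> 'n \<Rightarrow> 'n \<Rightarrow> real \<Rightarrow> real" where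
  "second_moment S w x i j r =
     1 / (2 * r\<^sup>2) * (1 / measure (weighted_measure S w) (ball x r)) *
       (LINT y:ball x r|lebesgue. (y - x) $ i * (y - x) $ j * w y)"

end

theory Submission
  imports Defs
begin

text \<open>
  Near \<open>x\<close>, expand \<open>u y - u x\<close> as \<open>grad u x \<bullet> (y - x)\<close> plus half the quadratic form of second
  derivatives plus \<open>o(\<bar>y - x\<bar>\<^sup>2)\<close>. Averaging over the ball of radius \<open>r\<close> against the weight and dividing by \<open>r\<^sup>2\<close>
  turns the first two terms into the first moment paired with \<open>grad u x\<close> and the second
  moments paired with the second derivatives, while the error disappears as \<open>r \<rightarrow> 0\<close>. Hence
  whenever the moments converge, the AMV Laplacian exists and is given by the limit moments
  (\<open>has_amv_laplacian_if_moments_converge\<close>). For \<open>w x = 0\<close> this convergence is assumed, and the claim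
  is immediate.

  For \<open>w x \<noteq> 0\<close> the moments do converge (\<open>moments_at_positive_weight\<close>). Expanding the weight to first order
  reduces them to the unweighted moments of the ball: the first and the mixed second moments
  vanish by reflection, and the second moment along an axis is \<open>r\<^sup>2 / (n + 2)\<close> times the volume
  (\<open>second_moment_ball\<close>). So the second moments tend to \<open>1 / (2 (n + 2))\<close> on the diagonal and
  \<open>0\<close> off it, and the first moment tends to \<open>grad w x / ((n + 2) w x)\<close>, which together
  give \<open>L\<^sub>w u / (2 (n + 2) w)\<close>. The constant \<open>n + 2\<close> is obtained without polar coordinates, by
  comparing integrals of \<open>max 0 (r\<^sup>2 - \<bar>y - x\<bar>\<^sup>2)\<close> before and after stretching one coordinate axis.
\<close>

section \<open>Integrals over balls\<close>

lemma set_integrable_ball_continuous: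
  fixes f :: "'a::euclidean_space \<Rightarrow> 'b::{banach, second_countable_topology}"
  assumes "continuous_on (cball x \<rho>) f" "r \<le> \<rho>"
  shows "set_integrable lborel (ball x r) f" "set_integrable lebesgue (ball x r) f"
    and "(LINT y:ball x r|lebesgue. f y) = (LINT y:ball x r|lborel. f y)"
proof -
  have "set_integrable lborel (cball x \<rho>) f"
    unfolding set_integrable_def by (rule borel_integrable_compact) (use assms in auto)
  then show A: "set_integrable lborel (ball x r) f"
    by (rule set_integrable_subset) (use assms in auto)
  then show "set_integrable lebesgue (ball x r) f"
    unfolding set_integrable_def
    by (metis integrable_completion borel_measurable_integrable)
  show "(LINT y:ball x r|lebesgue. f y) = (LINT y:ball x r|lborel. f y)"
    using A unfolding set_integrable_def set_lebesgue_integral_def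
    by (intro integral_completion borel_measurable_integrable)
qed

lemma set_integral_sum_distrib:
  fixes f :: "'i \<Rightarrow> 'a \<Rightarrow> 'b::{banach, second_countable_topology}"
  assumes "\<And>i. i \<in> I \<Longrightarrow> set_integrable M A (f i)"
  shows "(LINT y:A|M. (\<Sum>i\<in>I. f i y)) = (\<Sum>i\<in>I. LINT y:A|M. f i y)"
  using assms unfolding set_lebesgue_integral_def set_integrable_def
  by (simp add: scaleR_sum_right)

lemma set_integral_inner_right:
  assumes "set_integrable M A f"
  shows "(LINT y:A|M. c \<bullet> f y) = c \<bullet> (LINT y:A|M. f y)"
  using integral_inner_right[of c M "\<lambda>y. indicator A y *\<^sub>R f y"] assms
  unfolding set_lebesgue_integral_def set_integrable_def by simp

section \<open>Moments of Euclidean balls\<close>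

text \<open>Multiplies by \<open>c\<close> the coordinate along the unit vector \<open>k\<close>, measured from the centre \<open>x\<close>;
  for \<open>c = -1\<close> it is the reflection in the hyperplane through \<open>x\<close> orthogonal to \<open>k\<close>.\<close>

definition axis_stretch :: "'a::euclidean_space \<Rightarrow> 'a \<Rightarrow> real \<Rightarrow> 'a \<Rightarrow> 'a" where
  "axis_stretch x k c y = y + ((c - 1) * ((y - x) \<bullet> k)) *\<^sub>R k"

lemma lborel_axis_stretch:
  fixes f :: "'a::euclidean_space \<Rightarrow> real"
  assumes k: "k \<in> Basis" and c: "c \<noteq> 0" and f: "integrable lborel f"
  shows "integrable lborel (\<lambda>y. f (axis_stretch x k c y))"
    and "(LINT y|lborel. f y) = \<bar>c\<bar> * (LINT y|lborel. f (axis_stretch x k c y))"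
proof -
  let ?c = "\<lambda>j. if j = k then c else 1"
  let ?T = "axis_stretch x k c"
  have T: "?T = (\<lambda>y. - (((c - 1) * (x \<bullet> k)) *\<^sub>R k) + (\<Sum>j\<in>Basis. (?c j * (y \<bullet> j)) *\<^sub>R j))"
  proof (rule ext, rule euclidean_eqI)
    fix y b :: 'a assume "b \<in> Basis"
    then show "?T y \<bullet> b = (- (((c - 1) * (x \<bullet> k)) *\<^sub>R k) + (\<Sum>j\<in>Basis. (?c j * (y \<bullet> j)) *\<^sub>R j)) \<bullet> b"
      using k by (auto simp: axis_stretch_def inner_add_left inner_diff_left inner_Basis algebra_simps)
  qed
  have "(\<Prod>j\<in>Basis. \<bar>?c j\<bar>) = \<bar>c\<bar>"
    using k by (subst prod.remove[OF _ k]) auto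
  then have L: "lborel = density (distr lborel borel ?T) (\<lambda>_. ennreal \<bar>c\<bar>)"
    using lborel_affine_euclidean[of ?c "- (((c - 1) * (x \<bullet> k)) *\<^sub>R k)"] c
    unfolding T by (simp cong: if_cong)
  have [measurable]: "?T \<in> borel_measurable borel" "f \<in> borel_measurable borel"
    using f by (auto simp: axis_stretch_def[abs_def] dest: borel_measurable_integrable)
  have "integrable (density (distr lborel borel ?T) (\<lambda>_. ennreal \<bar>c\<bar>)) f"
    using f by (subst (asm) L)
  then show "integrable lborel (\<lambda>y. f (?T y))"
    using c by (simp add: integrable_density integrable_distr_eq)
  have "(LINT y|lborel. f y) = (LINT y|density (distr lborel borel ?T) (\<lambda>_. ennreal \<bar>c\<bar>). f y)"
    by (subst L) simp
  then show "(LINT y|lborel. f y) = \<bar>c\<bar> * (LINT y|lborel. f (?T y))"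
    by (simp add: integral_density integral_distr)
qed

lemma norm_axis_stretch:
  assumes "k \<in> Basis"
  shows "(norm (axis_stretch x k c y - x))\<^sup>2 = (norm (y - x))\<^sup>2 + (c\<^sup>2 - 1) * ((y - x) \<bullet> k)\<^sup>2"
proof -
  have *: "(norm (h + a *\<^sub>R k))\<^sup>2 = (norm h)\<^sup>2 + (2 * a * (h \<bullet> k) + a\<^sup>2)" for h a
    unfolding power2_norm_eq_inner using assms
    by (simp add: inner_add_left inner_add_right inner_commute[of k h] power2_eq_square algebra_simps)
  have "axis_stretch x k c y - x = (y - x) + ((c - 1) * ((y - x) \<bullet> k)) *\<^sub>R k"
    by (simp add: axis_stretch_def)
  moreover have "2 * ((c - 1) * b) * b + ((c - 1) * b)\<^sup>2 = (c\<^sup>2 - 1) * b\<^sup>2" for b :: real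
    by algebra
  ultimately show ?thesis by (simp only: *)
qed

text \<open>The reflection \<open>axis_stretch x k (-1)\<close> preserves both the ball and Lebesgue measure.\<close>

lemma set_integral_ball_odd:
  fixes f :: "'a::euclidean_space \<Rightarrow> real"
  assumes k: "k \<in> Basis" and int: "set_integrable lborel (ball x r) f"
    and odd: "\<And>y. f (axis_stretch x k (-1) y) = - f y"
  shows "(LINT y:ball x r|lborel. f y) = 0"
proof -
  let ?f = "\<lambda>y. indicator (ball x r) y *\<^sub>R f y"
  have int: "integrable lborel ?f" using int by (simp add: set_integrable_def)
  have "axis_stretch x k (-1) y \<in> ball x r \<longleftrightarrow> y \<in> ball x r" for y
    using norm_axis_stretch[OF k, of x "-1" y] by (simp add: dist_norm norm_minus_commute)
  then have "?f (axis_stretch x k (-1) y) = - ?f y" for y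
    by (simp add: indicator_def odd)
  then have "(LINT y|lborel. ?f y) = - (LINT y|lborel. ?f y)"
    using lborel_axis_stretch(2)[OF k _ int, of "-1" x] by simp
  then show ?thesis by (simp add: set_lebesgue_integral_def)
qed

lemma first_moment_ball:
  fixes x :: "'a::euclidean_space"
  assumes "k \<in> Basis"
  shows "(LINT y:ball x r|lborel. (y - x) \<bullet> k) = 0"
proof (rule set_integral_ball_odd[OF assms])
  show "set_integrable lborel (ball x r) (\<lambda>y. (y - x) \<bullet> k)"
    by (intro set_integrable_ball_continuous(1)[OF _ order.refl] continuous_intros)
  show "(axis_stretch x k (-1) y - x) \<bullet> k = - ((y - x) \<bullet> k)" for y
    using assms by (simp add: axis_stretch_def inner_diff_left inner_add_left algebra_simps)
qed

lemma mixed_second_moment_ball: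
  fixes x :: "'a::euclidean_space"
  assumes "k \<in> Basis" "l \<in> Basis" "k \<noteq> l"
  shows "(LINT y:ball x r|lborel. ((y - x) \<bullet> k) * ((y - x) \<bullet> l)) = 0"
proof (rule set_integral_ball_odd[OF assms(1)])
  show "set_integrable lborel (ball x r) (\<lambda>y. ((y - x) \<bullet> k) * ((y - x) \<bullet> l))"
    by (intro set_integrable_ball_continuous(1)[OF _ order.refl] continuous_intros)
  show "(axis_stretch x k (-1) y - x) \<bullet> k * ((axis_stretch x k (-1) y - x) \<bullet> l)
      = - ((y - x) \<bullet> k * ((y - x) \<bullet> l))" for y
    using assms by (simp add: axis_stretch_def inner_diff_left inner_add_left inner_Basis algebra_simps)
qed

text \<open>The idea is to stretch one axis instead of passing to polar coordinates. Let
  \<open>\<phi> = max 0 (r\<^sup>2 - \<bar>y - x\<bar>\<^sup>2)\<close> with integral \<open>C\<close>, and let \<open>I j\<close> be the second moment along \<open>j\<close>.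
  Stretching axis \<open>j\<close> by \<open>c\<close> changes the integral of \<open>\<phi>\<close> to \<open>C / c\<close> and adds \<open>(c\<^sup>2 - 1) ((y - x) \<bullet> j)\<^sup>2\<close> to
  \<open>\<bar>y - x\<bar>\<^sup>2\<close>. As \<open>t \<mapsto> max 0 (r\<^sup>2 - t)\<close> is convex, with slope \<open>-1\<close> where it is positive, this yields
  \<open>C \<le> C / c + (c\<^sup>2 - 1) I j\<close> for every \<open>c > 0\<close>. Both sides agree at \<open>c = 1\<close>, so comparing first-order
  terms from the two sides of \<open>1\<close> gives \<open>C = 2 I j\<close>. In particular all \<open>I j\<close> coincide, and
  \<open>C = r\<^sup>2 \<bar>ball x r\<bar> - (\<Sum>j. I j)\<close> then determines them.\<close>

lemma second_moment_ball:
  fixes x :: "'a::euclidean_space"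
  assumes k: "k \<in> Basis" and r: "0 \<le> r"
  shows "(LINT y:ball x r|lborel. ((y - x) \<bullet> k)\<^sup>2) = r\<^sup>2 * measure lborel (ball x r) / (DIM('a) + 2)"
proof -
  define I where "I j = (LINT y:ball x r|lborel. ((y - x) \<bullet> j)\<^sup>2)" for j
  define \<phi> where "\<phi> y = max 0 (r\<^sup>2 - (norm (y - x))\<^sup>2)" for y
  define C where "C = (LINT y|lborel. \<phi> y)"
  have intI: "set_integrable lborel (ball x r) (\<lambda>y. ((y - x) \<bullet> j)\<^sup>2)" for j
    by (intro set_integrable_ball_continuous(1)[OF _ order.refl] continuous_intros)
  have intn: "set_integrable lborel (ball x r) (\<lambda>y. (norm (y - x))\<^sup>2)"
    by (intro set_integrable_ball_continuous(1)[OF _ order.refl] continuous_intros)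
  have int1: "set_integrable lborel (ball x r) (\<lambda>y. r\<^sup>2)"
    by (intro set_integrable_ball_continuous(1)[OF _ order.refl] continuous_intros)
  have ball: "y \<in> ball x r \<longleftrightarrow> (norm (y - x))\<^sup>2 < r\<^sup>2" for y
    using r power_less_imp_less_base[of "norm (y - x)" 2 r] power_strict_mono[of "norm (y - x)" r 2]
    by (auto simp: dist_norm norm_minus_commute)
  have norm_sq: "(norm (y - x))\<^sup>2 = (\<Sum>j\<in>Basis. ((y - x) \<bullet> j)\<^sup>2)" for y
    unfolding power2_norm_eq_inner by (subst euclidean_inner) (simp add: power2_eq_square)
  have \<phi>_ind: "\<phi> = (\<lambda>y. indicator (ball x r) y *\<^sub>R (r\<^sup>2 - (norm (y - x))\<^sup>2))"
    by (rule ext) (auto simp: \<phi>_def ball indicator_def simp del: mem_ball)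
  have int\<phi>: "integrable lborel \<phi>"
    using set_integral_diff(1)[OF int1 intn] by (simp add: set_integrable_def \<phi>_ind)
  have "C = (LINT y:ball x r|lborel. r\<^sup>2) - (LINT y:ball x r|lborel. (norm (y - x))\<^sup>2)"
    using set_integral_diff(2)[OF int1 intn] by (simp add: C_def \<phi>_ind set_lebesgue_integral_def)
  also have "(LINT y:ball x r|lborel. (norm (y - x))\<^sup>2)
      = (LINT y:ball x r|lborel. (\<Sum>j\<in>Basis. ((y - x) \<bullet> j)\<^sup>2))"
    unfolding norm_sq ..
  also have "\<dots> = (\<Sum>j\<in>Basis. I j)"
    unfolding I_def by (rule set_integral_sum_distrib) (rule intI)
  also have "(LINT y:ball x r|lborel. r\<^sup>2) = r\<^sup>2 * measure lborel (ball x r)"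
    by (simp add: set_lebesgue_integral_def)
  finally have C_sum: "C = r\<^sup>2 * measure lborel (ball x r) - (\<Sum>j\<in>Basis. I j)" .
  have C_I: "C = 2 * I j" if j: "j \<in> Basis" for j
  proof -
    have main: "C \<le> C / c + (c\<^sup>2 - 1) * I j" if "c > 0" for c
    proof -
      let ?T = "axis_stretch x j c"
      have intT: "integrable lborel (\<lambda>y. \<phi> (?T y))" and eqT: "C = c * (LINT y|lborel. \<phi> (?T y))"
        using lborel_axis_stretch[OF j _ int\<phi>, of c x] that by (auto simp: C_def)
      have intJ: "integrable lborel (\<lambda>y. (c\<^sup>2 - 1) * (indicator (ball x r) y *\<^sub>R ((y - x) \<bullet> j)\<^sup>2))"
        using intI[of j] unfolding set_integrable_def by (rule integrable_mult_right)
      have "C \<le> (LINT y|lborel. \<phi> (?T y) + (c\<^sup>2 - 1) * (indicator (ball x r) y *\<^sub>R ((y - x) \<bullet> j)\<^sup>2))"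
        unfolding C_def
      proof (rule integral_mono[OF int\<phi>])
        show "integrable lborel (\<lambda>y. \<phi> (?T y) + (c\<^sup>2 - 1) * (indicator (ball x r) y *\<^sub>R ((y - x) \<bullet> j)\<^sup>2))"
          using intT intJ by (rule Bochner_Integration.integrable_add)
        \<comment> \<open>the subgradient inequality for \<open>t \<mapsto> max 0 (r\<^sup>2 - t)\<close>\<close>
        show "\<phi> y \<le> \<phi> (?T y) + (c\<^sup>2 - 1) * (indicator (ball x r) y *\<^sub>R ((y - x) \<bullet> j)\<^sup>2)" for y
          using norm_axis_stretch[OF j, of x c y]
          by (auto simp: \<phi>_def indicator_def ball simp del: mem_ball)
      qed
      also have "\<dots> = (LINT y|lborel. \<phi> (?T y)) + (c\<^sup>2 - 1) * I j"
        using Bochner_Integration.integral_add[OF intT intJ]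
        by (simp add: I_def set_lebesgue_integral_def)
      also have "(LINT y|lborel. \<phi> (?T y)) = C / c"
        using eqT that by simp
      finally show ?thesis .
    qed
    have lim: "((\<lambda>c. c * (c + 1) * I j) \<longlongrightarrow> 1 * (1 + 1) * I j) (at 1 within S)" for S
      by (intro tendsto_intros)
    \<comment> \<open>the factor \<open>c - 1\<close> changes sign at \<open>1\<close>: cancelling it bounds \<open>C\<close> from above for \<open>c > 1\<close> and from below for \<open>c < 1\<close>\<close>
    have main': "(c - 1) * C \<le> (c - 1) * (c * (c + 1) * I j)" if "c > 0" for c
    proof -
      have "c * C \<le> c * (C / c + (c\<^sup>2 - 1) * I j)"
        using main[OF that] that by (intro mult_left_mono) auto
      also have "\<dots> = C + c * (c\<^sup>2 - 1) * I j"
        using that by (simp add: field_simps)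
      finally show ?thesis by (simp add: algebra_simps power2_eq_square)
    qed
    have "C \<le> 1 * (1 + 1) * I j"
    proof (rule tendsto_lowerbound[OF lim[of "{1<..}"]])
      show "\<forall>\<^sub>F c in at_right 1. C \<le> c * (c + 1) * I j"
        using eventually_at_right_less[of 1]
      proof eventually_elim
        fix c :: real assume "1 < c"
        then show "C \<le> c * (c + 1) * I j" by (intro mult_left_le_imp_le[OF main']) simp_all
      qed
    qed simp
    moreover have "1 * (1 + 1) * I j \<le> C"
    proof (rule tendsto_upperbound[OF lim[of "{..<1}"]])
      have "\<forall>\<^sub>F c in at_left 1. c \<in> {0<..<1::real}"
        by (rule eventually_at_left_real) simp
      then show "\<forall>\<^sub>F c in at_left 1. c * (c + 1) * I j \<le> C"
      proof eventually_elim
        fix c :: real assume c: "c \<in> {0<..<1}"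
        then have "(1 - c) * (c * (c + 1) * I j) \<le> (1 - c) * C"
          using main'[of c] by (simp add: left_diff_distrib)
        then show "c * (c + 1) * I j \<le> C" by (rule mult_left_le_imp_le) (use c in simp)
      qed
    qed simp
    ultimately show ?thesis by simp
  qed
  have "(\<Sum>j\<in>Basis. I j) = (\<Sum>j\<in>(Basis::'a set). I k)"
    by (rule sum.cong) (use C_I C_I[OF k] in auto)
  then have "(DIM('a) + 2) * I k = r\<^sup>2 * measure lborel (ball x r)"
    using C_sum C_I[OF k] by (simp add: algebra_simps)
  then show ?thesis unfolding I_def[symmetric] by (simp add: field_simps)
qed

section \<open>Taylor expansion of first and second order\<close>

lemma has_derivative_grad:
  fixes f :: "real^'n \<Rightarrow> real"
  assumes "f differentiable (at y)"
  shows "(f has_derivative (\<lambda>h. grad f y \<bullet> h)) (at y)"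
proof -
  obtain f' where f': "(f has_derivative f') (at y)"
    using assms by (auto simp: differentiable_def)
  then interpret bounded_linear f' by (rule has_derivative_bounded_linear)
  have partial: "partial_deriv i f y = f' (axis i 1)" for i
  proof -
    have "((\<lambda>t::real. y + t *\<^sub>R axis i 1) has_derivative (\<lambda>t. t *\<^sub>R axis i 1)) (at 0)"
      by (auto intro!: derivative_eq_intros)
    then have "((\<lambda>t. f (y + t *\<^sub>R axis i 1)) has_derivative (\<lambda>t. f' (t *\<^sub>R axis i 1))) (at 0)"
      by (rule has_derivative_compose[where g = f and g' = f']) (use f' in simp)
    then have "((\<lambda>t. f (y + t *\<^sub>R axis i 1)) has_field_derivative f' (axis i 1)) (at 0)"
      by (simp add: has_field_derivative_def scaleR mult_commute_abs)
    then show ?thesis unfolding partial_deriv_def by (rule DERIV_imp_deriv)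
  qed
  have expand: "f' h = (\<Sum>i\<in>UNIV. h $ i * f' (axis i 1))" for h
  proof -
    have "f' h = f' (\<Sum>i\<in>UNIV. h $ i *\<^sub>R axis i 1)"
      using basis_expansion[of h] by (simp add: scalar_mult_eq_scaleR)
    then show ?thesis by (simp add: sum scaleR)
  qed
  have "f' h = grad f y \<bullet> h" for h
    unfolding expand[of h] by (simp add: grad_def inner_vec_def partial mult.commute)
  then have "f' = (\<lambda>h. grad f y \<bullet> h)" by (rule ext)
  with f' show ?thesis by simp
qed

lemma first_order_remainder:
  fixes f :: "real^'n \<Rightarrow> real"
  assumes "f differentiable (at x)" "0 < \<epsilon>"
  shows "\<forall>\<^sub>F y in nhds x. \<bar>f y - f x - grad f x \<bullet> (y - x)\<bar> \<le> \<epsilon> * norm (y - x)"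
proof -
  obtain d where "0 < d" and d: "\<And>y. norm (y - x) < d \<Longrightarrow>
      norm (f y - f x - grad f x \<bullet> (y - x)) \<le> \<epsilon> * norm (y - x)"
    using has_derivative_grad[OF assms(1)] assms(2) unfolding has_derivative_at_alt by blast
  then show ?thesis
    unfolding eventually_nhds_metric dist_norm real_norm_def by blast
qed

text \<open>The mean value theorem is applied on the segment from \<open>x\<close> to \<open>x + h\<close> to
  \<open>g t = f (x + t h) - t (grad f x \<bullet> h) - (t\<^sup>2 / 2) Q h\<close>. The derivative of \<open>g\<close> is \<open>\<Sum>j. h $ j * e j\<close>, where
  \<open>e j\<close> is the first-order remainder of the partial derivative \<open>\<partial>\<^sub>j f\<close> at \<open>x + t h\<close>, hence
  \<open>o(\<bar>h\<bar>)\<close> because \<open>\<partial>\<^sub>j f\<close> is differentiable at \<open>x\<close>.\<close>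

lemma second_order_remainder:
  fixes f :: "real^'n \<Rightarrow> real"
  assumes "open S" "x \<in> S" and f: "\<And>y. y \<in> S \<Longrightarrow> f differentiable (at y)"
    and pf: "\<And>j. partial_deriv j f differentiable (at x)" and "0 < \<epsilon>"
  shows "\<forall>\<^sub>F y in nhds x. \<bar>f y - f x - grad f x \<bullet> (y - x)
     - (1/2) * (\<Sum>i\<in>UNIV. \<Sum>j\<in>UNIV. partial_deriv i (partial_deriv j f) x * ((y - x) $ i * (y - x) $ j))\<bar>
       \<le> \<epsilon> * (norm (y - x))\<^sup>2"
proof -
  \<comment> \<open>each of the \<open>CARD('n)\<close> terms \<open>h $ j * e j\<close> gets an equal share of \<open>\<epsilon>\<close>\<close>
  define \<eta> where "\<eta> = \<epsilon> / CARD('n)"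
  have "0 < \<eta>" using \<open>0 < \<epsilon>\<close> by (simp add: \<eta>_def)
  define Q where "Q h = (\<Sum>i\<in>UNIV. \<Sum>j\<in>UNIV. partial_deriv i (partial_deriv j f) x * (h $ i * h $ j))" for h
  have Q: "Q h = (\<Sum>j\<in>UNIV. h $ j * (grad (partial_deriv j f) x \<bullet> h))" for h
    unfolding Q_def by (subst sum.swap) (simp add: grad_def inner_vec_def sum_distrib_left mult_ac)
  have "\<forall>\<^sub>F y in nhds x. y \<in> S \<and> (\<forall>j. \<bar>partial_deriv j f y - partial_deriv j f x
      - grad (partial_deriv j f) x \<bullet> (y - x)\<bar> \<le> \<eta> * norm (y - x))"
    by (intro eventually_conj eventually_all_finite eventually_nhds_in_open[OF assms(1,2)]
        first_order_remainder[OF pf \<open>0 < \<eta>\<close>])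
  then obtain \<delta> where \<delta>: "0 < \<delta>" and S: "\<And>y. dist y x < \<delta> \<Longrightarrow> y \<in> S"
    and small: "\<And>y j. dist y x < \<delta> \<Longrightarrow> \<bar>partial_deriv j f y - partial_deriv j f x
      - grad (partial_deriv j f) x \<bullet> (y - x)\<bar> \<le> \<eta> * norm (y - x)"
    unfolding eventually_nhds_metric by blast
  have "\<bar>f (x + h) - f x - grad f x \<bullet> h - (1/2) * Q h\<bar> \<le> \<epsilon> * (norm h)\<^sup>2" if h: "norm h < \<delta>" for h
  proof -
    define g where "g t = f (x + t *\<^sub>R h) - t * (grad f x \<bullet> h) - (t\<^sup>2 / 2) * Q h" for t
    define g' where "g' t = grad f (x + t *\<^sub>R h) \<bullet> h - grad f x \<bullet> h - t * Q h" for t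
    have near: "dist (x + t *\<^sub>R h) x < \<delta>" if "0 \<le> t" "t \<le> 1" for t
      using that h mult_left_le_one_le[of "norm h" t] by (simp add: dist_norm)
    have "(g has_real_derivative g' t) (at t)" if "0 \<le> t" "t \<le> 1" for t
    proof -
      have "((\<lambda>t. x + t *\<^sub>R h) has_derivative (\<lambda>s. s *\<^sub>R h)) (at t)"
        by (auto intro!: derivative_eq_intros)
      then have "((\<lambda>t. f (x + t *\<^sub>R h)) has_derivative (\<lambda>s. grad f (x + t *\<^sub>R h) \<bullet> (s *\<^sub>R h))) (at t)"
        using has_derivative_grad[OF f[OF S[OF near[OF that]]]] by (rule has_derivative_compose[where g = f and g' = "\<lambda>s. grad f (x + t *\<^sub>R h) \<bullet> s"])
      then have "((\<lambda>t. f (x + t *\<^sub>R h)) has_real_derivative grad f (x + t *\<^sub>R h) \<bullet> h) (at t)"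
        by (simp add: has_field_derivative_def mult_commute_abs)
      then show ?thesis unfolding g_def g'_def
        by (auto intro!: derivative_eq_intros)
    qed
    from MVT2[of 0 1 g g', OF _ this]
    obtain t where t: "0 < t" "t < 1" "g 1 - g 0 = g' t" by auto
    define e where "e j = partial_deriv j f (x + t *\<^sub>R h) - partial_deriv j f x
      - grad (partial_deriv j f) x \<bullet> (t *\<^sub>R h)" for j
    have e: "\<bar>e j\<bar> \<le> \<eta> * norm h" for j
    proof -
      have "\<bar>e j\<bar> \<le> \<eta> * norm (t *\<^sub>R h)"
        using small[OF near[of t], of j] t by (simp add: e_def)
      also have "\<dots> \<le> \<eta> * norm h"
        using t \<open>0 < \<eta>\<close> by (intro mult_left_mono) (auto simp: mult_left_le_one_le)
      finally show ?thesis .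
    qed
    have summand: "\<bar>h $ j * e j\<bar> \<le> norm h * (\<eta> * norm h)" for j
      unfolding abs_mult by (rule mult_mono[OF component_le_norm_cart e]) auto
    have "g' t = (\<Sum>j\<in>UNIV. h $ j * e j)"
      unfolding g'_def e_def Q
      by (simp add: grad_def inner_vec_def[of _ h] sum_subtractf sum.distrib algebra_simps sum_distrib_left)
    also have "\<bar>\<dots>\<bar> \<le> (\<Sum>j\<in>UNIV. \<bar>h $ j * e j\<bar>)"
      by (rule sum_abs)
    also have "\<dots> \<le> (\<Sum>j\<in>(UNIV::'n set). norm h * (\<eta> * norm h))"
      by (rule sum_mono) (rule summand)
    also have "\<dots> = \<epsilon> * (norm h)\<^sup>2"
      by (simp add: \<eta>_def power2_eq_square)
    finally show ?thesis
      using t(3) by (simp add: g_def algebra_simps)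
  qed
  from this[of "y - x" for y] show ?thesis
    unfolding eventually_nhds_metric Q_def[symmetric] using \<delta> by (auto simp: dist_norm)
qed

section \<open>Averages over small balls\<close>

text \<open>An error of order \<open>o(\<bar>y - x\<bar>\<^sup>k)\<close> is at most \<open>\<epsilon> r\<^sup>k\<close> on a small ball of radius \<open>r\<close>, and averaging
  against a nonnegative weight keeps that bound. If the weight has integral zero, the average is
  \<open>0\<close> by the convention \<open>1 / 0 = 0\<close>.\<close>

lemma weighted_average_remainder_tendsto_0:
  fixes g R :: "'a::euclidean_space \<Rightarrow> real"
  assumes "0 < \<rho>" and int: "\<And>r. r \<le> \<rho> \<Longrightarrow> set_integrable M (ball x r) g"
    "\<And>r. r \<le> \<rho> \<Longrightarrow> set_integrable M (ball x r) (\<lambda>y. g y * R y)"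
    and g: "\<And>y. y \<in> ball x \<rho> \<Longrightarrow> 0 \<le> g y"
    and R: "\<And>\<epsilon>. 0 < \<epsilon> \<Longrightarrow> \<forall>\<^sub>F y in nhds x. \<bar>R y\<bar> \<le> \<epsilon> * norm (y - x) ^ k"
  shows "((\<lambda>r. 1 / r ^ k * (1 / (LINT y:ball x r|M. g y)) * (LINT y:ball x r|M. g y * R y))
           \<longlongrightarrow> 0) (at_right 0)"
proof (rule tendstoI)
  fix e :: real assume "0 < e"
  then have "0 < e / 2" by simp
  from R[OF this] obtain \<delta> where \<delta>: "0 < \<delta>"
    and small: "\<And>y. dist y x < \<delta> \<Longrightarrow> \<bar>R y\<bar> \<le> e / 2 * norm (y - x) ^ k"
    unfolding eventually_nhds_metric by blast
  have "\<forall>\<^sub>F r in at_right 0. r \<in> {0<..<min \<rho> \<delta>}"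
    by (rule eventually_at_right_real) (use \<delta> \<open>0 < \<rho>\<close> in simp)
  then show "\<forall>\<^sub>F r in at_right 0. dist (1 / r ^ k * (1 / (LINT y:ball x r|M. g y))
      * (LINT y:ball x r|M. g y * R y)) 0 < e"
  proof eventually_elim
    fix r assume "r \<in> {0<..<min \<rho> \<delta>}"
    then have r: "0 < r" "r \<le> \<rho>" "r \<le> \<delta>" by auto
    let ?m = "LINT y:ball x r|M. g y"
    have bound: "\<bar>R y\<bar> \<le> e / 2 * r ^ k" if "y \<in> ball x r" for y
    proof -
      have "\<bar>R y\<bar> \<le> e / 2 * norm (y - x) ^ k"
        using small[of y] that r by (simp add: dist_commute)
      also have "\<dots> \<le> e / 2 * r ^ k"
        using that \<open>0 < e\<close> by (intro mult_left_mono power_mono) (auto simp: dist_norm norm_minus_commute)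
      finally show ?thesis .
    qed
    have g0: "0 \<le> g y" if "y \<in> ball x r" for y
      using g[of y] that r by simp
    have "\<bar>LINT y:ball x r|M. g y * R y\<bar> \<le> (LINT y:ball x r|M. \<bar>g y * R y\<bar>)"
      using set_integral_norm_bound[OF int(2)[OF r(2)]] by simp
    also have "\<dots> \<le> (LINT y:ball x r|M. (e / 2 * r ^ k) * g y)"
    proof (rule set_integral_mono)
      show "set_integrable M (ball x r) (\<lambda>y. \<bar>g y * R y\<bar>)"
        by (rule set_integrable_abs) (rule int r)+
      show "set_integrable M (ball x r) (\<lambda>y. (e / 2 * r ^ k) * g y)"
        using int(1)[OF r(2)] by simp
      show "\<bar>g y * R y\<bar> \<le> (e / 2 * r ^ k) * g y" if "y \<in> ball x r" for y
        using mult_right_mono[OF bound[OF that] g0[OF that]] g0[OF that]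
        by (simp add: abs_mult mult.commute)
    qed
    also have "\<dots> = e / 2 * r ^ k * ?m" by simp
    finally have I: "\<bar>LINT y:ball x r|M. g y * R y\<bar> \<le> e / 2 * r ^ k * ?m" .
    have m: "0 \<le> ?m"
      unfolding set_lebesgue_integral_def
      by (rule Bochner_Integration.integral_nonneg) (use g0 in \<open>auto simp: indicator_def\<close>)
    have "0 \<le> 1 / r ^ k * (1 / ?m)" using m r by simp
    from mult_left_mono[OF I this] abs_of_nonneg[OF this]
    have "\<bar>1 / r ^ k * (1 / ?m) * (LINT y:ball x r|M. g y * R y)\<bar>
        \<le> 1 / r ^ k * (1 / ?m) * (e / 2 * r ^ k * ?m)"
      unfolding abs_mult[of "1 / r ^ k * (1 / ?m)"] by simp
    also have "\<dots> \<le> e / 2" using r \<open>0 < e\<close> by simp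
    also have "\<dots> < e" using \<open>0 < e\<close> by simp
    finally show "dist (1 / r ^ k * (1 / ?m) * (LINT y:ball x r|M. g y * R y)) 0 < e"
      by (simp add: dist_norm)
  qed
qed

section \<open>From convergence of the moments to the AMV Laplacian\<close>

lemma set_integral_weighted_measure:
  fixes f w :: "real^'n \<Rightarrow> real"
  assumes "open S" and w: "continuous_on S w" "\<And>y. y \<in> S \<Longrightarrow> 0 \<le> w y"
    and sub: "ball x r \<subseteq> S" and f: "set_integrable lebesgue (ball x r) f"
  shows "(LINT y:ball x r|weighted_measure S w. f y) = (LINT y:ball x r|lebesgue. w y * f y)"
proof -
  have "(\<lambda>y. indicator S y *\<^sub>R w y) \<in> borel_measurable borel"
    using assms by (intro borel_measurable_continuous_on_indicator) auto
  then have "(\<lambda>y. indicator S y * w y) \<in> borel_measurable lebesgue"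
    by (simp add: measurable_completion)
  moreover have "(\<lambda>y. indicator (ball x r) y *\<^sub>R f y) \<in> borel_measurable lebesgue"
    using f unfolding set_integrable_def by (rule borel_measurable_integrable)
  ultimately have "(LINT y:ball x r|weighted_measure S w. f y)
      = (LINT y|lebesgue. (indicator S y * w y) *\<^sub>R (indicator (ball x r) y *\<^sub>R f y))"
    unfolding weighted_measure_def set_lebesgue_integral_def
    using w(2) by (intro integral_density) (auto simp: indicator_def)
  also have "\<dots> = (LINT y:ball x r|lebesgue. w y * f y)"
    unfolding set_lebesgue_integral_def using sub
    by (intro Bochner_Integration.integral_cong) (auto simp: indicator_def)
  finally show ?thesis .
qed

lemma measure_weighted_measure_ball:
  fixes w :: "real^'n \<Rightarrow> real"
  assumes "open S" "continuous_on S w" "\<And>y. y \<in> S \<Longrightarrow> 0 \<le> w y" "ball x r \<subseteq> S"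
  shows "measure (weighted_measure S w) (ball x r) = (LINT y:ball x r|lebesgue. w y)"
proof -
  have "set_integrable lebesgue (ball x r) (\<lambda>y. 1::real)"
    by (intro set_integrable_ball_continuous(2)[OF _ order.refl] continuous_intros)
  from set_integral_weighted_measure[OF assms this]
  show ?thesis by (simp add: set_lebesgue_integral_def weighted_measure_def)
qed

text \<open>Integrating the second-order expansion of \<open>u\<close> against the weight gives exactly the first and
  second moments, contracted with the gradient and the second derivatives of \<open>u\<close>; the remainder
  is \<open>o(\<bar>y - x\<bar>\<^sup>2)\<close>, so its average divided by \<open>r\<^sup>2\<close> vanishes in the limit. Convergence
  of the moments is a hypothesis where the weight vanishes and a consequence elsewhere, so this
  lemma carries both cases.\<close>

lemma has_amv_laplacian_if_moments_converge:
  fixes w u :: "real^'n \<Rightarrow> real"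
  assumes S: "open S" "x \<in> S" and w: "continuous_on S w" "\<And>y. y \<in> S \<Longrightarrow> 0 \<le> w y"
    and u: "\<And>y. y \<in> S \<Longrightarrow> u differentiable (at y)"
      "\<And>j. partial_deriv j u differentiable (at x)"
    and b: "(first_moment S w x \<longlongrightarrow> b) (at_right 0)"
    and a: "\<And>i j. (second_moment S w x i j \<longlongrightarrow> a i j) (at_right 0)"
  shows "has_amv_laplacian (weighted_measure S w) u x
    ((\<Sum>i\<in>UNIV. \<Sum>j\<in>UNIV. a i j * partial_deriv i (partial_deriv j u) x) + b \<bullet> grad u x)"
proof -
  obtain \<rho> where \<rho>: "0 < \<rho>" "cball x \<rho> \<subseteq> S"
    using S open_contains_cball by blast
  define D where "D i j = partial_deriv i (partial_deriv j u) x" for i j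
  define q where "q i j y = (y - x) $ i * (y - x) $ j * w y" for i j y
  define R where "R y = u y - u x - grad u x \<bullet> (y - x)
      - (1/2) * (\<Sum>i\<in>UNIV. \<Sum>j\<in>UNIV. D i j * ((y - x) $ i * (y - x) $ j))" for y
  have cw: "continuous_on (cball x \<rho>) w"
    using w(1) \<rho>(2) by (rule continuous_on_subset)
  have cu: "continuous_on (cball x \<rho>) u"
    using u(1) \<rho>(2) by (intro continuous_at_imp_continuous_on) (auto intro: differentiable_imp_continuous_within)
  have cR: "continuous_on (cball x \<rho>) R"
    unfolding R_def using cu by (intro continuous_intros)
  have cq: "continuous_on (cball x \<rho>) (q i j)" for i j
    unfolding q_def using cw by (intro continuous_intros)
  note int = set_integrable_ball_continuous(2)[where \<rho> = \<rho>]
  have lim_R: "((\<lambda>r. 1 / r\<^sup>2 * (1 / (LINT y:ball x r|lebesgue. w y))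
      * (LINT y:ball x r|lebesgue. w y * R y)) \<longlongrightarrow> 0) (at_right 0)"
  proof (rule weighted_average_remainder_tendsto_0[OF \<rho>(1)])
    show "set_integrable lebesgue (ball x r) w" if "r \<le> \<rho>" for r
      using cw that by (rule int)
    show "set_integrable lebesgue (ball x r) (\<lambda>y. w y * R y)" if "r \<le> \<rho>" for r
      using cw cR that by (intro int continuous_intros)
    show "0 \<le> w y" if "y \<in> ball x \<rho>" for y
      using w(2) \<rho>(2) that by force
    show "\<forall>\<^sub>F y in nhds x. \<bar>R y\<bar> \<le> \<epsilon> * (norm (y - x))\<^sup>2" if "0 < \<epsilon>" for \<epsilon>
      using second_order_remainder[OF S u that] unfolding R_def D_def .
  qed
  have "((\<lambda>r. 1 / r\<^sup>2 * (1 / (LINT y:ball x r|lebesgue. w y)) * (LINT y:ball x r|lebesgue. w y * R y)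
      + ((\<Sum>i\<in>UNIV. \<Sum>j\<in>UNIV. second_moment S w x i j r * D i j) + first_moment S w x r \<bullet> grad u x))
    \<longlongrightarrow> 0 + ((\<Sum>i\<in>UNIV. \<Sum>j\<in>UNIV. a i j * D i j) + b \<bullet> grad u x)) (at_right 0)"
    by (intro tendsto_intros lim_R a b)
  moreover have "\<forall>\<^sub>F r in at_right 0.
      1 / r\<^sup>2 * (1 / (LINT y:ball x r|lebesgue. w y)) * (LINT y:ball x r|lebesgue. w y * R y)
      + ((\<Sum>i\<in>UNIV. \<Sum>j\<in>UNIV. second_moment S w x i j r * D i j) + first_moment S w x r \<bullet> grad u x)
    = 1 / r\<^sup>2 * (1 / measure (weighted_measure S w) (ball x r))
        * (LINT y:ball x r|weighted_measure S w. u y - u x)"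
    using eventually_at_right_real[OF \<rho>(1)]
  proof eventually_elim
    fix r assume r: "r \<in> {0<..<\<rho>}"
    then have "r \<le> \<rho>" and sub: "ball x r \<subseteq> S" using \<rho>(2) by auto
    note int = int[OF _ \<open>r \<le> \<rho>\<close>]
    let ?m = "LINT y:ball x r|lebesgue. w y"
    have m: "measure (weighted_measure S w) (ball x r) = ?m"
      using w by (rule measure_weighted_measure_ball[OF S(1) _ _ sub])
    have int_h: "set_integrable lebesgue (ball x r) (\<lambda>y. w y *\<^sub>R (y - x))"
      using cw by (intro int continuous_intros)
    have int_l: "set_integrable lebesgue (ball x r) (\<lambda>y. grad u x \<bullet> (w y *\<^sub>R (y - x)))"
      using cw by (intro int continuous_intros)
    have int_q: "set_integrable lebesgue (ball x r) (\<lambda>y. D i j * q i j y)" for i j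
      using cq by (intro int continuous_intros)
    have int_s: "set_integrable lebesgue (ball x r) (\<lambda>y. \<Sum>j\<in>UNIV. D i j * q i j y)" for i
      using cq by (intro int continuous_intros)
    have int_ss: "set_integrable lebesgue (ball x r) (\<lambda>y. (1/2) * (\<Sum>i\<in>UNIV. \<Sum>j\<in>UNIV. D i j * q i j y))"
      using cq by (intro int continuous_intros)
    have int_R: "set_integrable lebesgue (ball x r) (\<lambda>y. w y * R y)"
      using cw cR by (intro int continuous_intros)
    have int_u: "set_integrable lebesgue (ball x r) (\<lambda>y. u y - u x)"
      using cu by (intro int continuous_intros)
    have "w y * (u y - u x) = w y * R y + (grad u x \<bullet> (w y *\<^sub>R (y - x))
        + (1/2) * (\<Sum>i\<in>UNIV. \<Sum>j\<in>UNIV. D i j * q i j y))" for y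
    proof -
      have "(\<Sum>i\<in>UNIV. \<Sum>j\<in>UNIV. D i j * q i j y)
          = w y * (\<Sum>i\<in>UNIV. \<Sum>j\<in>UNIV. D i j * ((y - x) $ i * (y - x) $ j))"
        unfolding q_def by (simp add: sum_distrib_left mult_ac)
      then show ?thesis unfolding R_def by (simp add: algebra_simps)
    qed
    then have "(LINT y:ball x r|lebesgue. w y * (u y - u x))
      = (LINT y:ball x r|lebesgue. w y * R y + (grad u x \<bullet> (w y *\<^sub>R (y - x))
        + (1/2) * (\<Sum>i\<in>UNIV. \<Sum>j\<in>UNIV. D i j * q i j y)))"
      by simp
    also have "\<dots> = (LINT y:ball x r|lebesgue. w y * R y)
       + ((LINT y:ball x r|lebesgue. grad u x \<bullet> (w y *\<^sub>R (y - x)))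
         + (LINT y:ball x r|lebesgue. (1/2) * (\<Sum>i\<in>UNIV. \<Sum>j\<in>UNIV. D i j * q i j y)))"
      using set_integral_add(2)[OF int_R set_integral_add(1)[OF int_l int_ss]]
        set_integral_add(2)[OF int_l int_ss] by simp
    also have "(LINT y:ball x r|lebesgue. grad u x \<bullet> (w y *\<^sub>R (y - x)))
        = grad u x \<bullet> (LINT y:ball x r|lebesgue. w y *\<^sub>R (y - x))"
      by (rule set_integral_inner_right[OF int_h])
    also have "(LINT y:ball x r|lebesgue. (1/2) * (\<Sum>i\<in>UNIV. \<Sum>j\<in>UNIV. D i j * q i j y))
        = (1/2) * (\<Sum>i\<in>UNIV. \<Sum>j\<in>UNIV. D i j * (LINT y:ball x r|lebesgue. q i j y))"
      by (subst set_integral_mult_right, subst set_integral_sum_distrib, rule int_s,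
          subst set_integral_sum_distrib, rule int_q, subst set_integral_mult_right) rule
    finally have I: "(LINT y:ball x r|weighted_measure S w. u y - u x)
      = (LINT y:ball x r|lebesgue. w y * R y) + (grad u x \<bullet> (LINT y:ball x r|lebesgue. w y *\<^sub>R (y - x))
        + (1/2) * (\<Sum>i\<in>UNIV. \<Sum>j\<in>UNIV. D i j * (LINT y:ball x r|lebesgue. q i j y)))"
      using set_integral_weighted_measure[OF S(1) w sub int_u] by simp
    have "(\<Sum>i\<in>UNIV. \<Sum>j\<in>UNIV. second_moment S w x i j r * D i j)
        = 1 / r\<^sup>2 * (1 / ?m) * ((1/2) * (\<Sum>i\<in>UNIV. \<Sum>j\<in>UNIV. D i j * (LINT y:ball x r|lebesgue. q i j y)))"
      unfolding second_moment_def m q_def by (simp add: sum_distrib_left mult_ac)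
    moreover have "first_moment S w x r \<bullet> grad u x
        = 1 / r\<^sup>2 * (1 / ?m) * (grad u x \<bullet> (LINT y:ball x r|lebesgue. w y *\<^sub>R (y - x)))"
      unfolding first_moment_def m by (simp add: inner_commute)
    ultimately show "1 / r\<^sup>2 * (1 / ?m) * (LINT y:ball x r|lebesgue. w y * R y)
      + ((\<Sum>i\<in>UNIV. \<Sum>j\<in>UNIV. second_moment S w x i j r * D i j) + first_moment S w x r \<bullet> grad u x)
    = 1 / r\<^sup>2 * (1 / measure (weighted_measure S w) (ball x r))
        * (LINT y:ball x r|weighted_measure S w. u y - u x)"
      unfolding I m by (simp add: distrib_left)
  qed
  ultimately show ?thesis
    unfolding has_amv_laplacian_def D_def by (simp add: Lim_transform_eventually)
qed

section \<open>Moments at a point of positive weight\<close>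

lemma ball_second_moments_cart:
  fixes x :: "real^'n"
  assumes "0 \<le> r"
  shows "(LINT y:ball x r|lebesgue. (y - x) $ i * (y - x) $ j)
    = (if i = j then 1 / (real CARD('n) + 2) else 0) * r\<^sup>2 * measure lborel (ball x r)"
proof -
  have "(LINT y:ball x r|lebesgue. (y - x) $ i * (y - x) $ j)
      = (LINT y:ball x r|lborel. (y - x) $ i * (y - x) $ j)"
    by (rule set_integrable_ball_continuous(3)[OF _ order.refl]) (intro continuous_intros)
  also have "\<dots> = (LINT y:ball x r|lborel. ((y - x) \<bullet> axis i 1) * ((y - x) \<bullet> axis j 1))"
    by (simp only: cart_eq_inner_axis)
  also have "\<dots> = (if i = j then 1 / (real CARD('n) + 2) else 0) * r\<^sup>2 * measure lborel (ball x r)"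
    using second_moment_ball[of "axis i 1" r x] mixed_second_moment_ball[of "axis i 1" "axis j 1" x r] assms
    by (auto simp: axis_in_Basis_iff axis_eq_axis power2_eq_square)
  finally show ?thesis .
qed

lemma ball_first_moment_cart:
  fixes x :: "real^'n"
  shows "(LINT y:ball x r|lebesgue. (y - x) $ i) = 0"
proof -
  have "(LINT y:ball x r|lebesgue. (y - x) $ i) = (LINT y:ball x r|lborel. (y - x) $ i)"
    by (rule set_integrable_ball_continuous(3)[OF _ order.refl]) (intro continuous_intros)
  also have "\<dots> = (LINT y:ball x r|lborel. (y - x) \<bullet> axis i 1)"
    by (simp only: cart_eq_inner_axis)
  also have "\<dots> = 0"
    by (rule first_moment_ball) (simp add: axis_in_Basis_iff)
  finally show ?thesis .
qed

text \<open>To find the scaled average of \<open>h\<close> it is enough to replace \<open>h\<close> by a function \<open>p\<close> with the same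
  expansion to order \<open>k\<close> at \<open>x\<close> whose ball integrals are known exactly.\<close>

lemma ball_average_tendsto:
  fixes h p :: "'a::euclidean_space \<Rightarrow> real"
  assumes "0 < \<rho>" and h: "continuous_on (cball x \<rho>) h" and p: "continuous_on (cball x \<rho>) p"
    and R: "\<And>\<epsilon>. 0 < \<epsilon> \<Longrightarrow> \<forall>\<^sub>F y in nhds x. \<bar>h y - p y\<bar> \<le> \<epsilon> * norm (y - x) ^ k"
    and int_p: "\<And>r. 0 < r \<Longrightarrow> (LINT y:ball x r|lebesgue. p y) = c * r ^ k * measure lborel (ball x r)"
  shows "((\<lambda>r. 1 / r ^ k * (1 / measure lborel (ball x r)) * (LINT y:ball x r|lebesgue. h y))
           \<longlongrightarrow> c) (at_right 0)"
proof -
  have vol: "(LINT y:ball x r|lebesgue. (1::real)) = measure lborel (ball x r)" for r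
    by (simp add: set_lebesgue_integral_def)
  have "((\<lambda>r. 1 / r ^ k * (1 / (LINT y:ball x r|lebesgue. 1)) * (LINT y:ball x r|lebesgue. 1 * (h y - p y)))
      \<longlongrightarrow> 0) (at_right 0)"
  proof (rule weighted_average_remainder_tendsto_0[OF assms(1)])
    show "set_integrable lebesgue (ball x r) (\<lambda>y. 1 * (h y - p y))" if "r \<le> \<rho>" for r
      using h p that by (intro set_integrable_ball_continuous(2)[where \<rho> = \<rho>] continuous_intros)
    show "set_integrable lebesgue (ball x r) (\<lambda>y. 1::real)" if "r \<le> \<rho>" for r
      using that by (intro set_integrable_ball_continuous(2)[where \<rho> = \<rho>] continuous_intros)
  qed (use R in auto)
  then have "((\<lambda>r. 1 / r ^ k * (1 / measure lborel (ball x r)) * (LINT y:ball x r|lebesgue. h y - p y) + c)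
      \<longlongrightarrow> 0 + c) (at_right 0)"
    unfolding vol by (intro tendsto_intros) simp
  moreover have "\<forall>\<^sub>F r in at_right 0.
      1 / r ^ k * (1 / measure lborel (ball x r)) * (LINT y:ball x r|lebesgue. h y - p y) + c
      = 1 / r ^ k * (1 / measure lborel (ball x r)) * (LINT y:ball x r|lebesgue. h y)"
    using eventually_at_right_real[OF assms(1)]
  proof eventually_elim
    fix r assume "r \<in> {0<..<\<rho>}"
    then have r: "0 < r" "r \<le> \<rho>" by auto
    have "(LINT y:ball x r|lebesgue. h y - p y)
        = (LINT y:ball x r|lebesgue. h y) - c * r ^ k * measure lborel (ball x r)"
      using set_integral_diff(2)[OF set_integrable_ball_continuous(2)[OF h r(2)]
          set_integrable_ball_continuous(2)[OF p r(2)]] int_p[OF r(1)] by simp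
    moreover have "measure lborel (ball x r) \<noteq> 0" using r by simp
    ultimately show "1 / r ^ k * (1 / measure lborel (ball x r)) * (LINT y:ball x r|lebesgue. h y - p y) + c
      = 1 / r ^ k * (1 / measure lborel (ball x r)) * (LINT y:ball x r|lebesgue. h y)"
      using r by (simp add: field_simps)
  qed
  ultimately show ?thesis by (simp add: Lim_transform_eventually)
qed

text \<open>Where \<open>w x \<noteq> 0\<close>, the weighted volume of the ball is asymptotic to \<open>w x\<close> times its Lebesgue
  volume, so the normalisation may be changed to the latter. For the second moments the weight may be
  replaced by the constant \<open>w x\<close>. For the first moment this constant contributes nothing, by
  symmetry of the ball, and the next term \<open>grad w x \<bullet> (y - x)\<close> of the expansion pairs with \<open>y - x\<close> to
  produce a second moment of the ball.\<close>

lemma moments_at_positive_weight: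
  fixes w :: "real^'n \<Rightarrow> real"
  assumes S: "open S" "x \<in> S" and w: "continuous_on S w" "\<And>y. y \<in> S \<Longrightarrow> 0 \<le> w y"
    and dw: "w differentiable (at x)" and wx: "w x \<noteq> 0"
  shows "(first_moment S w x \<longlongrightarrow> (1 / ((real CARD('n) + 2) * w x)) *\<^sub>R grad w x) (at_right 0)"
    and "(second_moment S w x i j \<longlongrightarrow> (if i = j then 1 / (2 * (real CARD('n) + 2)) else 0)) (at_right 0)"
proof -
  obtain \<rho> where \<rho>: "0 < \<rho>" "cball x \<rho> \<subseteq> S"
    using S open_contains_cball by blast
  have cw: "continuous_on (cball x \<rho>) w"
    using w(1) \<rho>(2) by (rule continuous_on_subset)
  let ?V = "\<lambda>r. measure lborel (ball x r)"
  let ?m = "\<lambda>r. LINT y:ball x r|lebesgue. w y"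
  let ?n = "real CARD('n) + 2"
  have w_near: "\<forall>\<^sub>F y in nhds x. \<bar>w y - w x\<bar> \<le> \<epsilon>" if "0 < \<epsilon>" for \<epsilon>
  proof -
    have "(w \<longlongrightarrow> w x) (nhds x)"
      using differentiable_imp_continuous_within[OF dw] by (simp add: tendsto_nhds_iff isCont_def)
    from tendstoD[OF this that] show ?thesis
      by eventually_elim (simp add: dist_norm)
  qed
  \<comment> \<open>the trivial factor \<open>1 / r ^ 0\<close> is the case \<open>k = 0\<close> of the averaging lemma\<close>
  have lim_m: "((\<lambda>r. 1 / r ^ 0 * (1 / ?V r) * ?m r) \<longlongrightarrow> w x) (at_right 0)"
    by (rule ball_average_tendsto[OF \<rho>(1) cw, where p = "\<lambda>_. w x"])
       (use w_near in \<open>auto simp: set_lebesgue_integral_def\<close>)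
  have ratio: "((\<lambda>r. 1 / r\<^sup>2 * (1 / measure (weighted_measure S w) (ball x r)) * (LINT y:ball x r|lebesgue. h y))
      \<longlongrightarrow> c / w x) (at_right 0)"
    if "((\<lambda>r. 1 / r\<^sup>2 * (1 / ?V r) * (LINT y:ball x r|lebesgue. h y)) \<longlongrightarrow> c) (at_right 0)" for h c
  proof (rule Lim_transform_eventually[OF tendsto_divide[OF that lim_m wx]])
    show "\<forall>\<^sub>F r in at_right 0. 1 / r\<^sup>2 * (1 / ?V r) * (LINT y:ball x r|lebesgue. h y) / (1 / r ^ 0 * (1 / ?V r) * ?m r)
        = 1 / r\<^sup>2 * (1 / measure (weighted_measure S w) (ball x r)) * (LINT y:ball x r|lebesgue. h y)"
      using eventually_at_right_real[OF \<rho>(1)]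
    proof eventually_elim
      fix r assume r: "r \<in> {0<..<\<rho>}"
      then have "ball x r \<subseteq> S" using \<rho>(2) by auto
      then have "measure (weighted_measure S w) (ball x r) = ?m r"
        using w by (intro measure_weighted_measure_ball[OF S(1)])
      with r show "1 / r\<^sup>2 * (1 / ?V r) * (LINT y:ball x r|lebesgue. h y) / (1 / r ^ 0 * (1 / ?V r) * ?m r)
        = 1 / r\<^sup>2 * (1 / measure (weighted_measure S w) (ball x r)) * (LINT y:ball x r|lebesgue. h y)"
        by simp
    qed
  qed
  show "(second_moment S w x i j \<longlongrightarrow> (if i = j then 1 / (2 * ?n) else 0)) (at_right 0)"
  proof -
    have "((\<lambda>r. 1 / r\<^sup>2 * (1 / ?V r) * (LINT y:ball x r|lebesgue. (y - x) $ i * (y - x) $ j * w y))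
        \<longlongrightarrow> w x * (if i = j then 1 / ?n else 0)) (at_right 0)"
    proof (rule ball_average_tendsto[OF \<rho>(1), where p = "\<lambda>y. w x * ((y - x) $ i * (y - x) $ j)"])
      show "continuous_on (cball x \<rho>) (\<lambda>y. (y - x) $ i * (y - x) $ j * w y)"
        using cw by (intro continuous_intros)
      show "continuous_on (cball x \<rho>) (\<lambda>y. w x * ((y - x) $ i * (y - x) $ j))"
        by (intro continuous_intros)
      show "\<forall>\<^sub>F y in nhds x. \<bar>(y - x) $ i * (y - x) $ j * w y - w x * ((y - x) $ i * (y - x) $ j)\<bar>
          \<le> \<epsilon> * (norm (y - x))\<^sup>2" if "0 < \<epsilon>" for \<epsilon>
        using w_near[OF that]
      proof eventually_elim
        fix y assume y: "\<bar>w y - w x\<bar> \<le> \<epsilon>"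
        have "(y - x) $ i * (y - x) $ j * w y - w x * ((y - x) $ i * (y - x) $ j)
            = (w y - w x) * ((y - x) $ i * (y - x) $ j)" by (simp add: algebra_simps)
        also have "\<bar>\<dots>\<bar> \<le> \<epsilon> * (norm (y - x) * norm (y - x))"
          unfolding abs_mult using y
          by (intro mult_mono component_le_norm_cart) auto
        finally show "\<bar>(y - x) $ i * (y - x) $ j * w y - w x * ((y - x) $ i * (y - x) $ j)\<bar>
          \<le> \<epsilon> * (norm (y - x))\<^sup>2" by (simp add: power2_eq_square)
      qed
      show "(LINT y:ball x r|lebesgue. w x * ((y - x) $ i * (y - x) $ j))
          = w x * (if i = j then 1 / ?n else 0) * r\<^sup>2 * ?V r" if "0 < r" for r
        using ball_second_moments_cart[of r x i j] that by simp
    qed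
    from tendsto_mult[OF tendsto_const[of "1/2"] ratio[OF this]]
    have "(second_moment S w x i j \<longlongrightarrow> 1/2 * (w x * (if i = j then 1 / ?n else 0) / w x)) (at_right 0)"
      by (simp add: second_moment_def[abs_def] mult_ac)
    then show ?thesis using wx by (cases "i = j") simp_all
  qed
  show "(first_moment S w x \<longlongrightarrow> (1 / (?n * w x)) *\<^sub>R grad w x) (at_right 0)"
  proof (rule vec_tendstoI)
    fix k
    \<comment> \<open>the first-order expansion of \<open>w\<close>, multiplied by the \<open>k\<close>-th coordinate of \<open>y - x\<close>\<close>
    define p where "p y = w x * (y - x) $ k
      + (\<Sum>l\<in>UNIV. grad w x $ l * ((y - x) $ l * (y - x) $ k))" for y
    have linear_part: "(\<Sum>l\<in>UNIV. grad w x $ l * (h $ l * h $ k)) = (grad w x \<bullet> h) * h $ k" for h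
      by (simp add: inner_vec_def sum_distrib_right mult.assoc)
    have "((\<lambda>r. 1 / r\<^sup>2 * (1 / ?V r) * (LINT y:ball x r|lebesgue. w y * (y - x) $ k))
        \<longlongrightarrow> grad w x $ k / ?n) (at_right 0)"
    proof (rule ball_average_tendsto[OF \<rho>(1), where p = p])
      show "continuous_on (cball x \<rho>) (\<lambda>y. w y * (y - x) $ k)"
        using cw by (intro continuous_intros)
      show "continuous_on (cball x \<rho>) p"
        unfolding p_def by (intro continuous_intros)
      show "\<forall>\<^sub>F y in nhds x. \<bar>w y * (y - x) $ k - p y\<bar> \<le> \<epsilon> * (norm (y - x))\<^sup>2" if "0 < \<epsilon>" for \<epsilon>
        using first_order_remainder[OF dw that]
      proof eventually_elim
        fix y assume y: "\<bar>w y - w x - grad w x \<bullet> (y - x)\<bar> \<le> \<epsilon> * norm (y - x)"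
        have "w y * (y - x) $ k - p y = (w y - w x - grad w x \<bullet> (y - x)) * (y - x) $ k"
          unfolding p_def linear_part by (simp add: left_diff_distrib)
        also have "\<bar>\<dots>\<bar> \<le> (\<epsilon> * norm (y - x)) * norm (y - x)"
          unfolding abs_mult using y by (intro mult_mono component_le_norm_cart) auto
        finally show "\<bar>w y * (y - x) $ k - p y\<bar> \<le> \<epsilon> * (norm (y - x))\<^sup>2"
          by (simp add: power2_eq_square)
      qed
      show "(LINT y:ball x r|lebesgue. p y) = grad w x $ k / ?n * r\<^sup>2 * ?V r" if "0 < r" for r
      proof -
        note int = set_integrable_ball_continuous(2)[OF _ order.refl]
        have "(LINT y:ball x r|lebesgue. p y) = (LINT y:ball x r|lebesgue. w x * (y - x) $ k)
            + (LINT y:ball x r|lebesgue. \<Sum>l\<in>UNIV. grad w x $ l * ((y - x) $ l * (y - x) $ k))"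
          unfolding p_def by (intro set_integral_add int continuous_intros)
        also have "\<dots> = (\<Sum>l\<in>UNIV. LINT y:ball x r|lebesgue. grad w x $ l * ((y - x) $ l * (y - x) $ k))"
          by (subst set_integral_sum_distrib, intro int continuous_intros)
             (simp add: ball_first_moment_cart del: vector_minus_component)
        also have "\<dots> = (\<Sum>l\<in>UNIV. grad w x $ l * ((if l = k then 1 / ?n else 0) * r\<^sup>2 * ?V r))"
          using ball_second_moments_cart[of r x _ k] that by simp
        also have "\<dots> = grad w x $ k / ?n * r\<^sup>2 * ?V r"
          by (simp add: if_distrib if_distribR cong: if_cong)
        finally show ?thesis .
      qed
    qed
    from ratio[OF this]
    have "((\<lambda>r. 1 / r\<^sup>2 * (1 / measure (weighted_measure S w) (ball x r))
        * (LINT y:ball x r|lebesgue. w y * (y - x) $ k)) \<longlongrightarrow> grad w x $ k / ?n / w x) (at_right 0)" .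
    moreover have "\<forall>\<^sub>F r in at_right 0. 1 / r\<^sup>2 * (1 / measure (weighted_measure S w) (ball x r))
        * (LINT y:ball x r|lebesgue. w y * (y - x) $ k) = first_moment S w x r $ k"
      using eventually_at_right_real[OF \<rho>(1)]
    proof eventually_elim
      fix r assume r: "r \<in> {0<..<\<rho>}"
      have "set_integrable lebesgue (ball x r) (\<lambda>y. w y *\<^sub>R (y - x))"
        using cw r by (intro set_integrable_ball_continuous(2)[where \<rho> = \<rho>] continuous_intros) auto
      from set_integral_inner_right[OF this, of "axis k 1"]
      show "1 / r\<^sup>2 * (1 / measure (weighted_measure S w) (ball x r))
        * (LINT y:ball x r|lebesgue. w y * (y - x) $ k) = first_moment S w x r $ k"
        by (simp add: first_moment_def inner_axis')
    qed
    ultimately show "((\<lambda>r. first_moment S w x r $ k) \<longlongrightarrow> ((1 / (?n * w x)) *\<^sub>R grad w x) $ k) (at_right 0)"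
      by (simp add: Lim_transform_eventually)
  qed
qed

section \<open>The AMV Laplacian of a weighted measure\<close>

theorem proposition2p2:
  fixes \<Omega> :: "(real^'n::finite) set" and w u :: "real^'n \<Rightarrow> real" and \<mu> :: "(real^'n) measure"
  defines "\<mu> \<equiv> weighted_measure \<Omega> w"
  assumes "open \<Omega>" and "connected \<Omega>"
    and "Ck_on 1 \<Omega> w" and "\<And>y. y \<in> \<Omega> \<Longrightarrow> 0 \<le> w y"
    and "\<And>z r. 0 < r \<Longrightarrow> ball z r \<subseteq> \<Omega> \<Longrightarrow> 0 < emeasure \<mu> (ball z r)"
    and "Ck_on 2 \<Omega> u"
  shows "(\<forall>x\<in>\<Omega>. w x \<noteq> 0 \<longrightarrow>
            has_amv_laplacian \<mu> u x
              (1 / (2 * (real CARD('n) + 2)) * (weighted_laplacian w u x / w x)))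
       \<and> (\<forall>x\<in>\<Omega>. w x = 0 \<longrightarrow>
            (\<forall>(b :: real^'n) (a :: 'n \<Rightarrow> 'n \<Rightarrow> real).
               (first_moment \<Omega> w x \<longlongrightarrow> b) (at_right 0) \<longrightarrow>
               (\<forall>i j. (second_moment \<Omega> w x i j \<longlongrightarrow> a i j) (at_right 0)) \<longrightarrow>
               has_amv_laplacian \<mu> u x
                 ((\<Sum>i\<in>UNIV. \<Sum>j\<in>UNIV. a i j * partial_deriv i (partial_deriv j u) x)
                    + b \<bullet> grad u x)))"
proof -
  have "w differentiable_on \<Omega>"
    using assms(4) unfolding One_nat_def Ck_on.simps by blast
  then have cw: "continuous_on \<Omega> w" and dw: "\<And>y. y \<in> \<Omega> \<Longrightarrow> w differentiable (at y)"
    using assms(2) by (auto simp: differentiable_imp_continuous_on differentiable_on_eq_differentiable_at)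
  have "u differentiable_on \<Omega>" "\<And>j. partial_deriv j u differentiable_on \<Omega>"
    using assms(7) unfolding numeral_2_eq_2 Ck_on.simps by blast+
  then have du: "\<And>y. y \<in> \<Omega> \<Longrightarrow> u differentiable (at y)"
      "\<And>y j. y \<in> \<Omega> \<Longrightarrow> partial_deriv j u differentiable (at y)"
    using assms(2) by (auto simp: differentiable_on_eq_differentiable_at)
  have amv: "has_amv_laplacian \<mu> u x
      ((\<Sum>i\<in>UNIV. \<Sum>j\<in>UNIV. a i j * partial_deriv i (partial_deriv j u) x) + b \<bullet> grad u x)"
    if "x \<in> \<Omega>" "(first_moment \<Omega> w x \<longlongrightarrow> b) (at_right 0)"
      "\<And>i j. (second_moment \<Omega> w x i j \<longlongrightarrow> a i j) (at_right 0)" for x b a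
    unfolding \<mu>_def
    by (rule has_amv_laplacian_if_moments_converge[OF assms(2) that(1) cw])
       (use that assms(5) du in auto)
  have "has_amv_laplacian \<mu> u x (1 / (2 * (real CARD('n) + 2)) * (weighted_laplacian w u x / w x))"
    if x: "x \<in> \<Omega>" and wx: "w x \<noteq> 0" for x
  proof -
    let ?n = "real CARD('n) + 2"
    have moments: "(first_moment \<Omega> w x \<longlongrightarrow> (1 / (?n * w x)) *\<^sub>R grad w x) (at_right 0)"
      "\<And>i j. (second_moment \<Omega> w x i j \<longlongrightarrow> (if i = j then 1 / (2 * ?n) else 0)) (at_right 0)"
      using moments_at_positive_weight[OF assms(2) x cw _ dw[OF x] wx] assms(5) by blast+
    have rescale: "1 / (N * W) * q = 1 / (2 * N) * (2 * q / W)" for N W q :: real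
      by simp
    have "(\<Sum>i\<in>UNIV. \<Sum>j\<in>UNIV. (if i = j then 1 / (2 * ?n) else 0) * partial_deriv i (partial_deriv j u) x)
        = 1 / (2 * ?n) * laplacian u x"
      by (simp add: laplacian_def sum_distrib_left if_distrib if_distribR cong: if_cong)
    moreover have "((1 / (?n * w x)) *\<^sub>R grad w x) \<bullet> grad u x
        = 1 / (2 * ?n) * (2 * (grad w x \<bullet> grad u x) / w x)"
      using rescale[of ?n "w x" "grad w x \<bullet> grad u x"] by simp
    moreover have "1 / (2 * ?n) * (weighted_laplacian w u x / w x)
        = 1 / (2 * ?n) * laplacian u x + 1 / (2 * ?n) * (2 * (grad w x \<bullet> grad u x) / w x)"
      unfolding weighted_laplacian_def add_divide_distrib distrib_left using wx by simp
    ultimately show ?thesis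
      using amv[OF x moments] by simp
  qed
  with amv show ?thesis by blast
qed

end
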